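(* For every $\alpha,\varepsilon\in(0,1/7]$ there exists $n_0$ such that the following holds for every integer $n\ge n_0$. Let $H$ be a $3$-graph on $n$ vertices such that $$e(H)\ge \binom{n}{3}-\binom{n-\alpha n}{3}+\varepsilon n^3.$$ Then $H$ contains a $Y_{3,2}$-tiling covering at least $4\alpha n$ vertices.
   Context: A $3$-graph ($3$-uniform hypergraph) $H=(V,E)$ consists of a finite vertex set $V$ and a family $E$ of $3$-element subsets of $V$; $e(H)=|E|$. $Y_{3,2}$ is the $3$-graph on four vertices consisting of two edges that intersect in exactly two vertices. A $Y_{3,2}$-tiling in $H$ is a collection of vertex-disjoint copies of $Y_{3,2}$ in $H$ (not necessarily induced); it covers the vertices of its copies. For real $x$, $\binom{x}{3}=x(x-1)(x-2)/6$. *)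

theory Defs
  imports Complex_Main
begin

type_synonym 'a hypergraph = "'a set \<times> 'a set set"

definition verts :: "'a hypergraph \<Rightarrow> 'a set" where
  "verts H = fst H"

definition edges :: "'a hypergraph \<Rightarrow> 'a set set" where
  "edges H = snd H"

definition three_graph :: "'a hypergraph \<Rightarrow> bool" where
  "three_graph H \<longleftrightarrow> finite (verts H) \<and> (\<forall>e \<in> edges H. e \<subseteq> verts H \<and> card e = 3)"

definition is_Y32 :: "'a hypergraph \<Rightarrow> bool" where
  "is_Y32 Y \<longleftrightarrow> three_graph Y \<and> card (verts Y) = 4 \<and>
     (\<exists>e f. edges Y = {e, f} \<and> e \<noteq> f \<and> card (e \<inter> f) = 2)"

(* Not required to be induced. *)
definition subhypergraph :: "'a hypergraph \<Rightarrow> 'a hypergraph \<Rightarrow> bool" where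
  "subhypergraph F H \<longleftrightarrow> verts F \<subseteq> verts H \<and> edges F \<subseteq> edges H"

definition Y32_tiling :: "'a hypergraph \<Rightarrow> 'a hypergraph set \<Rightarrow> bool" where
  "Y32_tiling H T \<longleftrightarrow> (\<forall>Y \<in> T. is_Y32 Y \<and> subhypergraph Y H) \<and>
     pairwise (\<lambda>Y Z. disjnt (verts Y) (verts Z)) T"

definition covered :: "'a hypergraph set \<Rightarrow> 'a set" where
  "covered T = (\<Union>Y \<in> T. verts Y)"

end

(*
A maximum tiling T with t < alpha n tiles is improved by local exchanges. Let L be the uncovered set.
If a vertex v of a tile has a large link in L, then v together with three vertices of L can replace
its tile, so the other three vertices of that tile are as good as uncovered. Adding them to L and
iterating boundedly often yields a set S of a vertices, one from each of a tiles, such that almost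
no remaining tile has a vertex with large link in L. Let b = t - a be the number of remaining tiles
and N = n - a. Apart from the triples meeting S, there are few triples with at least two vertices
in L. Call a pair of vertices rich if it has at least 10 common neighbours in L. Three disjoint rich
pairs between two tiles would gain a tile, so there are at most 7 rich pairs between them unless two
vertices of one tile are rich to the whole other tile, and a tile can be the target of such a
configuration only once (four disjoint rich pairs on three tiles would gain a tile). Hence the edges
on the N vertices outside S give at most 21 b^2 (N - 4b) + 64 b^3 + o(n^3) ordered triples, which is at most
N^3 - (N - b)^3 + o(n^3) because the difference of the main terms is 3b (N - b) (N - 7b), which is
nonnegative for 7t <= n.
*)
theory Submission
  imports Defs "HOL-Library.Disjoint_Sets"
begin

section \<open>Tilings by vertex sets, greedy selection and exchange\<close>

text \<open>Only the vertex set of a copy of Y_{3,2} is kept, since all exchanges depend only on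
  which vertices a copy uses. Actual copies are recovered in \<open>tiling_Y32\<close>.\<close>

definition yset :: "'a set set \<Rightarrow> 'a set \<Rightarrow> bool" where
  "yset E Q \<longleftrightarrow> (\<exists>a b c d. distinct [a, b, c, d] \<and> Q = {a, b, c, d} \<and> {a, b, c} \<in> E \<and> {a, b, d} \<in> E)"

definition tiling :: "'a set \<Rightarrow> 'a set set \<Rightarrow> 'a set set \<Rightarrow> bool" where
  "tiling V E T \<longleftrightarrow> (\<forall>Y\<in>T. yset E Y \<and> Y \<subseteq> V) \<and> disjoint T"

lemma yset_card: "yset E Q \<Longrightarrow> card Q = 4"
  unfolding yset_def by auto

lemma yset_finite: "yset E Q \<Longrightarrow> finite Q"
  unfolding yset_def by auto

text \<open>The members are picked one index at a time. Before each pick, \<open>X0\<close> and the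
  earlier sets together have at most \<open>k\<close> elements, so the hypothesis supplies a member
  avoiding all of them.\<close>

lemma greedy_disjoint_selection:
  fixes F :: "'i \<Rightarrow> 'a set set"
  assumes "finite I"
    and "\<And>i X. i \<in> I \<Longrightarrow> finite X \<Longrightarrow> card X \<le> k \<Longrightarrow> \<exists>p\<in>F i. p \<inter> X = {} \<and> finite p \<and> card p \<le> c"
    and "finite X0" and "card X0 + c * card I \<le> k"
  shows "\<exists>f. (\<forall>i\<in>I. f i \<in> F i \<and> f i \<inter> X0 = {} \<and> finite (f i) \<and> card (f i) \<le> c) \<and>
    disjoint_family_on f I"
  using assms
proof (induction I rule: finite_induct)
  case empty
  then show ?case by (auto simp: disjoint_family_on_def)
next
  case (insert i I)
  have "card X0 + c * card I \<le> k" using insert.prems(3) insert.hyps by simp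
  then obtain f where f: "\<forall>j\<in>I. f j \<in> F j \<and> f j \<inter> X0 = {} \<and> finite (f j) \<and> card (f j) \<le> c"
      and d: "disjoint_family_on f I"
    using insert.IH insert.prems(1,2) by auto
  let ?X = "X0 \<union> (\<Union>j\<in>I. f j)"
  have fin: "finite ?X" using f insert.hyps insert.prems(2) by auto
  have "card (\<Union>j\<in>I. f j) \<le> (\<Sum>j\<in>I. card (f j))" using insert.hyps by (simp add: card_UN_le)
  also have "\<dots> \<le> (\<Sum>j\<in>I. c)" using f by (intro sum_mono) auto
  finally have "card (\<Union>j\<in>I. f j) \<le> c * card I" by (simp add: mult.commute)
  then have "card ?X \<le> k"
    using card_Un_le[of X0 "\<Union>j\<in>I. f j"] \<open>card X0 + c * card I \<le> k\<close> by linarith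
  then obtain p where p: "p \<in> F i" "p \<inter> ?X = {}" "finite p" "card p \<le> c"
    using insert.prems(1)[of i ?X] fin by auto
  show ?case
  proof (intro exI[of _ "f(i := p)"] conjI ballI)
    fix j assume "j \<in> insert i I"
    then show "(f(i := p)) j \<in> F j" "(f(i := p)) j \<inter> X0 = {}" "finite ((f(i := p)) j)"
      "card ((f(i := p)) j) \<le> c" using f p by auto
  next
    show "disjoint_family_on (f(i := p)) (insert i I)"
      using d p(2) insert.hyps(2) unfolding disjoint_family_on_def by (auto split: if_splits)
  qed
qed

text \<open>The cardinality is exact: a tile lying in both \<open>P\<close> and \<open>T - R\<close>
  would be disjoint from itself, while every tile has four vertices.\<close>

lemma tiling_exchange:
  assumes T: "tiling V E T" "finite T" and R: "R \<subseteq> T" and P: "tiling V E P" "finite P"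
    and disj: "\<And>p Y. p \<in> P \<Longrightarrow> Y \<in> T - R \<Longrightarrow> p \<inter> Y = {}"
  shows "tiling V E ((T - R) \<union> P)" and "card ((T - R) \<union> P) = card T - card R + card P"
proof -
  show "tiling V E ((T - R) \<union> P)"
    unfolding tiling_def
  proof
    show "\<forall>Y\<in>T - R \<union> P. yset E Y \<and> Y \<subseteq> V" using T P by (auto simp: tiling_def)
    show "disjoint (T - R \<union> P)"
      using T(1) P(1) disj unfolding tiling_def disjoint_def by (smt (verit) Diff_iff Int_commute Un_iff)
  qed
  have "(T - R) \<inter> P = {}"
  proof (rule ccontr)
    assume "(T - R) \<inter> P \<noteq> {}"
    then obtain Y where Y: "Y \<in> T - R" "Y \<in> P" by auto
    then have "Y = {}" using disj by blast
    then show False using Y P yset_card[of E Y] by (auto simp: tiling_def)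
  qed
  then show "card ((T - R) \<union> P) = card T - card R + card P"
    using T P R by (simp add: card_Un_disjoint card_Diff_subset finite_subset)
qed

section \<open>Bipartite graphs on 4 + 4 vertices without a 3-matching\<close>

(* Without a 3-matching, the edges avoiding x pairwise intersect, hence form a star. *)
lemma bipartite_heavy_vertex:
  assumes R: "R \<subseteq> A \<times> B" and A: "finite A" "card A = 4" and B: "finite B" "card B = 4"
    and R8: "8 \<le> card R"
    and nomatch: "\<And>p q r. p \<in> R \<Longrightarrow> q \<in> R \<Longrightarrow> r \<in> R \<Longrightarrow>
      distinct [fst p, fst q, fst r] \<Longrightarrow> \<not> distinct [snd p, snd q, snd r]"
    and x: "3 \<le> card (R `` {x})"
  shows "\<exists>x'. x \<noteq> x' \<and> x \<in> A \<and> x' \<in> A \<and> {x, x'} \<times> B \<subseteq> R"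
proof -
  define R' where "R' = {p \<in> R. fst p \<noteq> x}"
  have xB: "R `` {x} \<subseteq> B" using R by auto
  then have x4: "card (R `` {x}) \<le> 4" using B card_mono by metis
  have xA: "x \<in> A"
  proof -
    have "R `` {x} \<noteq> {}" using x by auto
    then show ?thesis using R by auto
  qed
  have split: "R = R' \<union> Pair x ` (R `` {x})" by (auto simp: R'_def)
  have "card (Pair x ` (R `` {x})) = card (R `` {x})" by (intro card_image) (auto simp: inj_on_def)
  then have "card R \<le> card R' + card (R `` {x})" using split card_Un_le[of R' "Pair x ` (R `` {x})"] by simp
  then have R'4: "4 \<le> card R'" and R'8: "8 \<le> card R' + card (R `` {x})" using R8 x4 by auto
  have meet: "fst p = fst q \<or> snd p = snd q" if pq: "p \<in> R'" "q \<in> R'" for p q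
  proof (rule ccontr)
    assume ne: "\<not> ?thesis"
    have "card {snd p, snd q} \<le> 2" by (simp add: card_insert_if)
    then have "\<not> R `` {x} \<subseteq> {snd p, snd q}" using x card_mono[of "{snd p, snd q}" "R `` {x}"] by auto
    then obtain c where "(x, c) \<in> R" "c \<noteq> snd p" "c \<noteq> snd q" by auto
    then show False using nomatch[of "(x, c)" p q] pq ne by (auto simp: R'_def)
  qed
  have "R' \<noteq> {}" using R'4 by auto
  then obtain p where p: "p \<in> R'" by auto
  have row: "fst q = fst p" if q: "q \<in> R'" for q
  proof (rule ccontr)
    assume ne: "fst q \<noteq> fst p"
    \<comment> \<open>If \<open>p\<close> and \<open>q\<close> differ in the first coordinate, every
      edge of \<open>R'\<close> passes through their common second coordinate, which leaves room for
      only three edges.\<close>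
    have "R' \<subseteq> (A - {x}) \<times> {snd p}"
    proof
      fix r assume r: "r \<in> R'"
      have "snd r = snd p" using meet[OF r p] meet[OF r q] meet[OF p q] ne by auto
      then show "r \<in> (A - {x}) \<times> {snd p}" using r R by (cases r) (auto simp: R'_def)
    qed
    then have "card R' \<le> card ((A - {x}) \<times> {snd p})" using A by (intro card_mono) auto
    also have "\<dots> = 3" using A xA by (simp add: card_cartesian_product)
    finally show False using R'4 by simp
  qed
  have sub: "R' \<subseteq> {fst p} \<times> B"
  proof
    fix r assume "r \<in> R'"
    then show "r \<in> {fst p} \<times> B" using row[of r] R by (cases r) (auto simp: R'_def)
  qed
  have c4: "card ({fst p} \<times> B) = 4" using B by (simp add: card_cartesian_product)
  then have R': "R' = {fst p} \<times> B" using sub R'4 B by (intro card_seteq) auto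
  have "R `` {x} = B" using xB R' c4 R'8 B by (intro card_seteq) auto
  moreover have "fst p \<in> A" "x \<noteq> fst p" using p R by (auto simp: R'_def)
  moreover have "R' \<subseteq> R" by (auto simp: R'_def)
  ultimately show ?thesis using R' xA by (intro exI[of _ "fst p"]) auto
qed

text \<open>A vertex of degree at least 3 is handled by \<open>bipartite_heavy_vertex\<close>,
  applied to the converse relation if the vertex lies in \<open>B\<close>. If all degrees are at
  most 2, a 3-matching is found greedily.\<close>

lemma bipartite_no_3_matching:
  assumes R: "R \<subseteq> A \<times> B" and A: "finite A" "card A = 4" and B: "finite B" "card B = 4"
    and R8: "8 \<le> card R"
    and nomatch: "\<And>p q r. p \<in> R \<Longrightarrow> q \<in> R \<Longrightarrow> r \<in> R \<Longrightarrow>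
      distinct [fst p, fst q, fst r] \<Longrightarrow> \<not> distinct [snd p, snd q, snd r]"
  shows "(\<exists>x x'. x \<noteq> x' \<and> x \<in> A \<and> x' \<in> A \<and> {x, x'} \<times> B \<subseteq> R) \<or>
    (\<exists>y y'. y \<noteq> y' \<and> y \<in> B \<and> y' \<in> B \<and> A \<times> {y, y'} \<subseteq> R)"
proof (cases "(\<exists>x. 3 \<le> card (R `` {x})) \<or> (\<exists>y. 3 \<le> card (R\<inverse> `` {y}))")
  case True
  then show ?thesis
  proof
    assume "\<exists>x. 3 \<le> card (R `` {x})"
    then show ?thesis using bipartite_heavy_vertex[OF R A B R8 nomatch] by blast
  next
    assume "\<exists>y. 3 \<le> card (R\<inverse> `` {y})"
    then obtain y where y: "3 \<le> card (R\<inverse> `` {y})" by auto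
    have "\<exists>y'. y \<noteq> y' \<and> y \<in> B \<and> y' \<in> B \<and> {y, y'} \<times> A \<subseteq> R\<inverse>"
    proof (rule bipartite_heavy_vertex[OF _ B A _ _ y])
      show "R\<inverse> \<subseteq> B \<times> A" using R by auto
      show "8 \<le> card (R\<inverse>)" using R8 by simp
      fix p q r assume pqr: "p \<in> R\<inverse>" "q \<in> R\<inverse>" "r \<in> R\<inverse>" "distinct [fst p, fst q, fst r]"
      show "\<not> distinct [snd p, snd q, snd r]"
      proof
        assume ds: "distinct [snd p, snd q, snd r]"
        have "prod.swap p \<in> R" "prod.swap q \<in> R" "prod.swap r \<in> R" using pqr by auto
        from nomatch[OF this] ds pqr(4) show False by simp
      qed
    qed
    then obtain y' where y': "y \<noteq> y'" "y \<in> B" "y' \<in> B" "{y, y'} \<times> A \<subseteq> R\<inverse>" by blast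
    then have "A \<times> {y, y'} \<subseteq> R" by auto
    then show ?thesis using y'(1-3) by blast
  qed
next
  case False
  have finR: "finite R" using R A B finite_subset by blast
  \<comment> \<open>At most two edges, \<open>p\<close> included, share the first endpoint of
    \<open>p\<close>, and at most one further edge shares the second. Deleting two such
    neighbourhoods from 8 edges leaves at least 8 - 3 - 3 = 2.\<close>
  have touch: "card {q \<in> R. fst q = fst p \<or> snd q = snd p} \<le> 3" if "p \<in> R" for p
  proof -
    let ?X = "Pair (fst p) ` (R `` {fst p})" and ?Y = "(\<lambda>x. (x, snd p)) ` (R\<inverse> `` {snd p} - {fst p})"
    have "fst p \<in> R\<inverse> `` {snd p}" using that by (cases p) auto
    moreover have "card (R\<inverse> `` {snd p}) \<le> 2" using False by (metis not_less_eq_eq numeral_2_eq_2 numeral_3_eq_3)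
    moreover have "finite (R\<inverse> `` {snd p})" "finite (R `` {fst p})" using finR by (auto intro: finite_Image)
    ultimately have "card (R\<inverse> `` {snd p} - {fst p}) \<le> 1" by simp
    then have Y: "card ?Y \<le> 1"
      using card_image_le[of "R\<inverse> `` {snd p} - {fst p}" "\<lambda>x. (x, snd p)"] \<open>finite (R\<inverse> `` {snd p})\<close> by simp
    have "card (R `` {fst p}) \<le> 2" using False by (metis not_less_eq_eq numeral_2_eq_2 numeral_3_eq_3)
    then have X: "card ?X \<le> 2" using card_image_le[of "R `` {fst p}" "Pair (fst p)"] \<open>finite (R `` {fst p})\<close> by simp
    have "{q \<in> R. fst q = fst p \<or> snd q = snd p} \<subseteq> ?X \<union> ?Y"
    proof
      fix q assume "q \<in> {q \<in> R. fst q = fst p \<or> snd q = snd p}"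
      then show "q \<in> ?X \<union> ?Y" by (cases p; cases q) auto
    qed
    moreover have "finite (?X \<union> ?Y)"
      using \<open>finite (R `` {fst p})\<close> \<open>finite (R\<inverse> `` {snd p})\<close> by simp
    ultimately have "card {q \<in> R. fst q = fst p \<or> snd q = snd p} \<le> card (?X \<union> ?Y)"
      by (intro card_mono)
    then show ?thesis using X Y card_Un_le[of ?X ?Y] by linarith
  qed
  let ?N = "\<lambda>p. {q \<in> R. fst q = fst p \<or> snd q = snd p}"
  have "R \<noteq> {}" using R8 by auto
  then obtain p where p: "p \<in> R" by auto
  have "card R - card (?N p) \<le> card (R - ?N p)" using finR by (intro diff_card_le_card_Diff) auto
  then have 5: "5 \<le> card (R - ?N p)" using touch[OF p] R8 by linarith
  then have "R - ?N p \<noteq> {}" by force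
  then obtain q where q: "q \<in> R - ?N p" by blast
  have "card (R - ?N p) - card (?N q) \<le> card (R - ?N p - ?N q)"
    using finR by (intro diff_card_le_card_Diff) auto
  then have "2 \<le> card (R - ?N p - ?N q)" using touch[of q] q 5 by force
  then have "R - ?N p - ?N q \<noteq> {}" by force
  then obtain r where "r \<in> R - ?N p - ?N q" by blast
  then show ?thesis using nomatch[of p q r] p q by auto
qed

section \<open>Counting ordered triples\<close>

text \<open>Triples are ordered and may repeat vertices. The number of all triples in a set is then
  an exact cube, the count is symmetric in its arguments, and an edge is counted six times when all
  three sets contain it.\<close>

definition triples :: "'a set set \<Rightarrow> 'a set \<Rightarrow> 'a set \<Rightarrow> 'a set \<Rightarrow> nat" where
  "triples E P Q R = (\<Sum>x\<in>P. \<Sum>y\<in>Q. \<Sum>z\<in>R. of_bool ({x, y, z} \<in> E))"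

lemma triples_swap12: "triples E P Q R = triples E Q P R"
  unfolding triples_def by (subst sum.swap) (simp add: insert_commute)

lemma triples_swap23: "triples E P Q R = triples E P R Q"
  unfolding triples_def by (subst sum.swap) (simp add: insert_commute)

lemma triples_Un:
  assumes "finite P" "finite P'" "P \<inter> P' = {}"
  shows "triples E (P \<union> P') Q R = triples E P Q R + triples E P' Q R"
  unfolding triples_def using assms by (rule sum.union_disjoint)

lemma triples_card:
  "finite R \<Longrightarrow> triples E P Q R = (\<Sum>x\<in>P. \<Sum>y\<in>Q. card {z \<in> R. {x, y, z} \<in> E})"
  unfolding triples_def by (simp add: sum_of_bool_eq Int_def)

lemma triples_le: "triples E P Q R \<le> card P * card Q * card R"
proof -
  have "triples E P Q R \<le> (\<Sum>x\<in>P. \<Sum>y\<in>Q. \<Sum>z\<in>R. 1)"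
    unfolding triples_def by (intro sum_mono) auto
  then show ?thesis by simp
qed

text \<open>The eight blocks are grouped by the number of coordinates in \<open>W\<close>; symmetry
  identifies the blocks of one group.\<close>

lemma triples_cube_Un:
  assumes "finite L" "finite W" "L \<inter> W = {}"
  shows "triples E (L \<union> W) (L \<union> W) (L \<union> W) =
    triples E L L L + 3 * triples E W L L + 3 * triples E W W L + triples E W W W"
proof -
  note U = triples_Un[OF assms, of E]
  have "triples E P (L \<union> W) R = triples E P L R + triples E P W R" for P R
    using U triples_swap12 by metis
  moreover have "triples E P R (L \<union> W) = triples E P R L + triples E P R W" for P R
    using calculation triples_swap23 by metis
  moreover have "triples E L W L = triples E W L L" "triples E L L W = triples E W L L"
    "triples E W L W = triples E W W L" "triples E L W W = triples E W W L"
    using triples_swap12 triples_swap23 by metis+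
  ultimately show ?thesis using U by simp
qed

text \<open>Passing to the complement of \<open>E\<close> turns the claim into monotonicity: the
  non-edge triples inside \<open>D\<close> are among those inside \<open>V\<close>. The additive
  form avoids subtraction of natural numbers.\<close>

lemma triples_outside:
  assumes "finite V" "D \<subseteq> V"
  shows "triples E V V V + card D ^ 3 \<le> card V ^ 3 + triples E D D D"
proof -
  have c: "triples E X X X + triples (- E) X X X = card X ^ 3" for X
  proof -
    have "of_bool P + of_bool (\<not> P) = (1::nat)" for P by simp
    then show ?thesis unfolding triples_def by (simp add: power3_eq_cube flip: sum.distrib)
  qed
  have "triples (- E) D D D \<le> triples (- E) V D D"
    unfolding triples_def using assms by (intro sum_mono2) auto
  also have "\<dots> \<le> triples (- E) V V D"
    unfolding triples_def using assms by (intro sum_mono sum_mono2) auto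
  also have "\<dots> \<le> triples (- E) V V V"
    unfolding triples_def using assms by (intro sum_mono sum_mono2) auto
  finally show ?thesis using c[of V] c[of D] by linarith
qed

lemma card_edges_triples:
  assumes V: "finite V" and E: "\<And>e. e \<in> E \<Longrightarrow> e \<subseteq> V \<and> card e = 3"
  shows "6 * card E \<le> triples E V V V"
proof -
  let ?O = "\<lambda>e. {(x, y, z). {x, y, z} = e}"
  have finE: "finite E" using E V by (meson PowI finite_Pow_iff finite_subset subsetI)
  have sub: "?O e \<subseteq> V \<times> V \<times> V" if "e \<in> E" for e using E[OF that] by auto
  have fin: "finite (?O e)" if "e \<in> E" for e using sub[OF that] V finite_subset by blast
  have "6 \<le> card (?O e)" if eE: "e \<in> E" for e
  proof -
    obtain a b c where e: "e = {a, b, c}" "a \<noteq> b" "b \<noteq> c" "a \<noteq> c"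
      using E[OF eE] unfolding card_3_iff by metis
    have "card {(a, b, c), (a, c, b), (b, a, c), (b, c, a), (c, a, b), (c, b, a)} \<le> card (?O e)"
      using fin[OF eE] e(1) by (intro card_mono) auto
    then show ?thesis using e by simp
  qed
  then have "6 * card E \<le> (\<Sum>e\<in>E. card (?O e))" using sum_mono[of E "\<lambda>_. 6" "\<lambda>e. card (?O e)"] by simp
  also have "\<dots> = card (\<Union>e\<in>E. ?O e)"
    using finE fin by (intro card_UN_disjoint[symmetric]) auto
  also have "(\<Union>e\<in>E. ?O e) = (V \<times> V \<times> V) \<inter> {(x, y, z). {x, y, z} \<in> E}"
    using E by auto
  also have "card \<dots> = (\<Sum>p\<in>V \<times> V \<times> V. of_bool (p \<in> {(x, y, z). {x, y, z} \<in> E}))"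
    using V by (subst sum_of_bool_eq) auto
  also have "\<dots> = triples E V V V"
    unfolding triples_def by (simp add: sum.cartesian_product case_prod_beta)
  finally show ?thesis .
qed

section \<open>Maximum tilings and the vertices that can be released from them\<close>

locale max_tiling =
  fixes V :: "'a set" and E T :: "'a set set"
  assumes finV: "finite V"
    and edge: "\<And>e. e \<in> E \<Longrightarrow> e \<subseteq> V \<and> card e = 3"
    and til: "tiling V E T"
    and max: "\<And>T'. tiling V E T' \<Longrightarrow> card T' \<le> card T"
begin

lemma tiling_finite: "tiling V E T' \<Longrightarrow> finite T'"
  using finV unfolding tiling_def by (meson PowI finite_Pow_iff finite_subset subsetI)

lemma T_disj: "Y \<in> T \<Longrightarrow> Z \<in> T \<Longrightarrow> Y \<noteq> Z \<Longrightarrow> Y \<inter> Z = {}"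
  using til unfolding tiling_def disjoint_def by blast

lemma T_tile: "Y \<in> T \<Longrightarrow> yset E Y \<and> Y \<subseteq> V \<and> card Y = 4 \<and> finite Y"
  using til yset_card yset_finite unfolding tiling_def by blast

lemma edge_distinct: assumes "{x, y, z} \<in> E" shows "x \<noteq> y \<and> y \<noteq> z \<and> x \<noteq> z"
  using edge[OF assms] by (auto simp: card_insert_if split: if_splits)

lemma card_Union_tiles: assumes "B \<subseteq> T" shows "card (\<Union>B) = 4 * card B"
proof -
  have "card (\<Union>B) = sum card B"
    proof (rule card_Union_disjoint)
    show "disjoint B" using assms T_disj unfolding disjoint_def by blast
    show "finite Y" if "Y \<in> B" for Y using assms T_tile that by blast
  qed
  also have "\<dots> = (\<Sum>Y\<in>B. 4)" using assms T_tile by (intro sum.cong) auto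
  finally show ?thesis by simp
qed

lemma yset_cherry: assumes "{x, y, z} \<in> E" "{x, y, z'} \<in> E" "z \<noteq> z'" shows "yset E {x, y, z, z'}"
  using assms edge_distinct[OF assms(1)] edge_distinct[OF assms(2)] unfolding yset_def
  by (intro exI[of _ x] exI[of _ y] exI[of _ z] exI[of _ z']) auto

(* s picks one vertex of each tile of A; all other vertices outside the tiles of T - A count as uncovered. *)
definition rest :: "'a set set \<Rightarrow> ('a set \<Rightarrow> 'a) \<Rightarrow> 'a set" where
  "rest A s = V - s ` A - \<Union>(T - A)"

text \<open>This makes precise that \<open>rest A s\<close> is as good as uncovered: any at most
  \<open>q\<close> of its vertices are missed by some tiling of maximum size that still contains the
  tiles outside \<open>A\<close>.\<close>

definition free :: "'a set set \<Rightarrow> ('a set \<Rightarrow> 'a) \<Rightarrow> nat \<Rightarrow> bool" where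
  "free A s q \<longleftrightarrow> (\<forall>Q \<subseteq> rest A s. card Q \<le> q \<longrightarrow>
     (\<exists>T'. tiling V E T' \<and> card T' = card T \<and> T - A \<subseteq> T' \<and> Q \<inter> \<Union>T' = {}))"

definition link :: "'a set \<Rightarrow> 'a \<Rightarrow> nat" where
  "link L v = (\<Sum>x\<in>L. card {y \<in> L. {v, x, y} \<in> E})"

text \<open>The threshold is linear in the number of vertices: for large \<open>K\<close> it
  survives the removal of boundedly many vertices, while all vertices below it contribute only
  quadratically many triples.\<close>

definition strong :: "nat \<Rightarrow> 'a set set \<Rightarrow> ('a set \<Rightarrow> 'a) \<Rightarrow> 'a set set" where
  "strong K A s = {Y \<in> T - A. \<exists>v\<in>Y. K * card V \<le> link (rest A s) v}"

text \<open>If every vertex of \<open>L\<close> outside \<open>X\<close> had at most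
  \<open>k + 1\<close> partners in the link of \<open>v\<close>, there would be fewer than
  \<open>(2 * k + 2) * card V\<close> ordered pairs. So some \<open>x\<close> has
  \<open>k + 2\<close> partners, two of which remain after \<open>X\<close> is removed.\<close>

lemma link_cherry:
  assumes "L \<subseteq> V" "V \<noteq> {}" and v: "K * card V \<le> link L v" and X: "finite X" "card X \<le> k"
    and K: "2 * k + 2 \<le> K"
  shows "\<exists>p. p \<subseteq> L \<and> yset E (insert v p) \<and> v \<notin> p \<and> p \<inter> X = {} \<and> finite p \<and> card p = 3"
proof -
  have finL: "finite L" using assms(1) finV finite_subset by blast
  have cL: "card L \<le> card V" using assms(1) finV card_mono by blast
  have "\<exists>x\<in>L - X. k + 2 \<le> card {y \<in> L. {v, x, y} \<in> E}"
  proof (rule ccontr)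
    assume neg: "\<not> ?thesis"
    have "link L v = (\<Sum>x\<in>L \<inter> X. card {y \<in> L. {v, x, y} \<in> E}) + (\<Sum>x\<in>L - X. card {y \<in> L. {v, x, y} \<in> E})"
      unfolding link_def by (rule sum.Int_Diff[OF finL])
    also have "\<dots> \<le> (\<Sum>x\<in>L \<inter> X. card V) + (\<Sum>x\<in>L - X. k + 1)"
    proof (intro add_mono sum_mono)
      fix x show "card {y \<in> L. {v, x, y} \<in> E} \<le> card V"
        using assms(1) finV by (intro card_mono) auto
    next
      fix x assume "x \<in> L - X"
      then have "\<not> k + 2 \<le> card {y \<in> L. {v, x, y} \<in> E}" using neg by blast
      then show "card {y \<in> L. {v, x, y} \<in> E} \<le> k + 1" by simp
    qed
    also have "\<dots> = card (L \<inter> X) * card V + card (L - X) * (k + 1)" by simp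
    also have "\<dots> \<le> k * card V + card V * (k + 1)"
    proof (intro add_mono mult_right_mono)
      show "card (L \<inter> X) \<le> k" using X card_mono[of X "L \<inter> X"] by auto
      show "card (L - X) \<le> card V" using cL finL card_mono[of L "L - X"] by auto
    qed auto
    also have "\<dots> < (2 * k + 2) * card V"
      using assms(2) finV card_gt_0_iff[of V] by (simp add: algebra_simps)
    also have "\<dots> \<le> K * card V" using K by (intro mult_right_mono) auto
    finally show False using v by simp
  qed
  then obtain x where x: "x \<in> L" "x \<notin> X" "k + 2 \<le> card {y \<in> L. {v, x, y} \<in> E}" by auto
  have "2 \<le> card ({y \<in> L. {v, x, y} \<in> E} - X)"
    using x(3) X diff_card_le_card_Diff[OF X(1), of "{y \<in> L. {v, x, y} \<in> E}"] by linarith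
  then obtain S where "S \<subseteq> {y \<in> L. {v, x, y} \<in> E} - X" "card S = 2"
    by (meson obtain_subset_with_card_n)
  then obtain y y' where y: "y \<noteq> y'" "{y, y'} \<subseteq> {y \<in> L. {v, x, y} \<in> E} - X"
    by (auto simp: card_2_iff)
  then have e: "{v, x, y} \<in> E" "{v, x, y'} \<in> E" by auto
  note d = edge_distinct[OF e(1)] edge_distinct[OF e(2)]
  show ?thesis
    using x y d yset_cherry[OF e y(1)] by (intro exI[of _ "{x, y, y'}"]) auto
qed

lemma free_mono: "free A s q \<Longrightarrow> q' \<le> q \<Longrightarrow> free A s q'"
  unfolding free_def by (meson le_trans)

lemma rest_subset: "rest A s \<subseteq> V" and finite_rest: "finite (rest A s)"
  unfolding rest_def using finV by auto

lemma free_empty: "free {} s q"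
  unfolding free_def rest_def using til by (intro allI impI exI[of _ T]) auto

(* A chosen vertex with large link forms a tile with three vertices of the rest, which releases
   the other three vertices of its own tile. *)
lemma free_step:
  assumes A: "A \<subseteq> T" "free A s (4 * q)" and K: "2 * (4 * q) + 2 \<le> K" and V: "V \<noteq> {}"
    and s': "\<And>Y. Y \<in> A \<Longrightarrow> s' Y = s Y"
      "\<And>Y. Y \<in> strong K A s \<Longrightarrow> s' Y \<in> Y \<and> K * card V \<le> link (rest A s) (s' Y)"
  shows "free (A \<union> strong K A s) s' q"
  unfolding free_def
proof (intro allI impI)
  let ?St = "strong K A s"
  let ?A = "A \<union> ?St"
  let ?L = "rest A s"
  fix Q assume Q: "Q \<subseteq> rest ?A s'" "card Q \<le> q"
  have St: "?St \<subseteq> T - A" by (auto simp: strong_def)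
  have finQ: "finite Q" using Q(1) finite_rest finite_subset by blast
  \<comment> \<open>Only the strong tiles met by \<open>Q\<close> have to be replaced. There are at
    most \<open>q\<close> of them, since disjoint tiles use different vertices of
    \<open>Q\<close>.\<close>
  define R where "R = {Y \<in> ?St. Y \<inter> Q \<noteq> {}}"
  have RT: "R \<subseteq> T - A" "R \<subseteq> ?St" using St by (auto simp: R_def)
  have finR: "finite R" using RT tiling_finite[OF til] by (auto intro: finite_subset)
  have "\<forall>Y\<in>R. \<exists>x. x \<in> Y \<and> x \<in> Q" by (auto simp: R_def)
  then obtain g where g: "\<forall>Y\<in>R. g Y \<in> Y \<and> g Y \<in> Q" by metis
  have "inj_on g R"
  proof (rule inj_onI)
    fix Y Z assume YZ: "Y \<in> R" "Z \<in> R" "g Y = g Z"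
    then have "g Y \<in> Y \<inter> Z" using g by auto
    then show "Y = Z" using T_disj[of Y Z] YZ RT by auto
  qed
  then have cR: "card R \<le> q"
    using g card_inj_on_le[of g R Q] finQ Q(2) by (meson image_subsetI le_trans)
  \<comment> \<open>Together, \<open>Q\<close> and the three new vertices for each tile of
    \<open>R\<close> amount to at most \<open>q + 3 * q\<close> vertices. This is the bound behind
    both the condition on \<open>K\<close> and the assumption
    \<open>free A s (4 * q)\<close>.\<close>
  have "\<exists>f. (\<forall>Y\<in>R. f Y \<in> {p. p \<subseteq> ?L \<and> yset E (insert (s' Y) p) \<and> s' Y \<notin> p} \<and> f Y \<inter> Q = {} \<and> finite (f Y) \<and> card (f Y) \<le> 3) \<and>
    disjoint_family_on f R"
  proof (rule greedy_disjoint_selection[where k = "4 * q"])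
    fix Y and X :: "'a set" assume Y: "Y \<in> R" and X: "finite X" "card X \<le> 4 * q"
    have "K * card V \<le> link ?L (s' Y)" using s'(2) Y RT by blast
    from link_cherry[OF rest_subset V this X K]
    obtain p where "p \<subseteq> ?L" "yset E (insert (s' Y) p)" "s' Y \<notin> p" "p \<inter> X = {}" "finite p" "card p = 3"
      by blast
    then show "\<exists>p\<in>{p. p \<subseteq> ?L \<and> yset E (insert (s' Y) p) \<and> s' Y \<notin> p}. p \<inter> X = {} \<and> finite p \<and> card p \<le> 3"
      by (intro bexI[of _ p]) auto
  qed (use finR finQ cR Q in auto)
  then obtain f where f: "\<And>Y. Y \<in> R \<Longrightarrow> f Y \<subseteq> ?L \<and> yset E (insert (s' Y) (f Y)) \<and> s' Y \<notin> f Y \<and> f Y \<inter> Q = {} \<and> finite (f Y) \<and> card (f Y) \<le> 3"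
    and fd: "disjoint_family_on f R" by auto
  let ?Q = "(Q \<inter> ?L) \<union> (\<Union>Y\<in>R. f Y)"
  have "card (\<Union>Y\<in>R. f Y) \<le> (\<Sum>Y\<in>R. card (f Y))" using finR by (rule card_UN_le)
  also have "\<dots> \<le> (\<Sum>Y\<in>R. 3)" using f by (intro sum_mono) auto
  finally have "card (\<Union>Y\<in>R. f Y) \<le> 3 * q" using cR by simp
  moreover have "card (Q \<inter> ?L) \<le> q" using Q(2) finQ card_mono[of Q "Q \<inter> ?L"] by auto
  ultimately have "card ?Q \<le> 4 * q" using card_Un_le[of "Q \<inter> ?L" "\<Union>Y\<in>R. f Y"] by linarith
  moreover have "?Q \<subseteq> ?L" using f by auto
  ultimately obtain T' where T': "tiling V E T'" "card T' = card T" "T - A \<subseteq> T'" "?Q \<inter> \<Union>T' = {}"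
    using A(2) unfolding free_def by meson
  have T'd: "Y \<inter> Z = {}" if "Y \<in> T'" "Z \<in> T'" "Y \<noteq> Z" for Y Z
    using T'(1) that unfolding tiling_def disjoint_def by blast
  have sY: "s' Y \<in> Y" if "Y \<in> R" for Y using s'(2) RT that by auto
  define h where "h = (\<lambda>Y. insert (s' Y) (f Y))"
  have hd: "h Y \<inter> h Z = {}" if YZ: "Y \<in> R" "Z \<in> R" "Y \<noteq> Z" for Y Z
  proof -
    have YZd: "Y \<inter> Z = {}" using YZ T_disj RT by blast
    have fYZ: "f Y \<inter> f Z = {}" using fd YZ unfolding disjoint_family_on_def by blast
    have L: "s' U \<in> U" "s' U \<notin> ?L" "f U \<subseteq> ?L" if "U \<in> R" for U
      using sY[OF that] f[OF that] that RT(1) unfolding rest_def by auto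
    have "s' Y \<noteq> s' Z" using L(1)[OF YZ(1)] L(1)[OF YZ(2)] YZd by auto
    moreover have "s' Y \<notin> f Z" using L(2)[OF YZ(1)] L(3)[OF YZ(2)] by auto
    moreover have "s' Z \<notin> f Y" using L(2)[OF YZ(2)] L(3)[OF YZ(1)] by auto
    ultimately show ?thesis using fYZ unfolding h_def by auto
  qed
  have hP: "tiling V E (h ` R)"
    unfolding tiling_def disjoint_def
  proof (intro conjI ballI impI)
    fix Y assume "Y \<in> h ` R"
    then obtain Z where Z: "Z \<in> R" "Y = h Z" by auto
    show "yset E Y" using f[OF Z(1)] Z(2) by (simp add: h_def)
    have "s' Z \<in> V" using sY[OF Z(1)] Z RT T_tile by blast
    then show "Y \<subseteq> V" using f[OF Z(1)] Z rest_subset unfolding h_def by blast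
  next
    fix Y Z assume "Y \<in> h ` R" "Z \<in> h ` R" "Y \<noteq> Z"
    then show "Y \<inter> Z = {}" using hd by blast
  qed
  have "inj_on h R"
  proof (rule inj_onI)
    fix Y Z assume YZ: "Y \<in> R" "Z \<in> R" "h Y = h Z"
    then have "h Y \<inter> h Z \<noteq> {}" by (auto simp: h_def)
    then show "Y = Z" using hd YZ by blast
  qed
  then have ch: "card (h ` R) = card R" by (rule card_image)
  have RT': "R \<subseteq> T'" using RT T' by auto
  have hT: "p \<inter> Y = {}" if p: "p \<in> h ` R" and Y: "Y \<in> T' - R" for p Y
  proof -
    obtain Z where Z: "Z \<in> R" "p = h Z" using p by auto
    have "Z \<inter> Y = {}" using T'd[of Z Y] Z RT' Y by auto
    moreover have "f Z \<inter> Y = {}" using T'(4) Z Y by auto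
    ultimately show ?thesis using sY[OF Z(1)] Z(2) by (auto simp: h_def)
  qed
  note ex = tiling_exchange[OF T'(1) tiling_finite[OF T'(1)] RT' hP tiling_finite[OF hP] hT]
  show "\<exists>T'. tiling V E T' \<and> card T' = card T \<and> T - ?A \<subseteq> T' \<and> Q \<inter> \<Union>T' = {}"
  proof (intro exI[of _ "(T' - R) \<union> h ` R"] conjI)
    show "tiling V E ((T' - R) \<union> h ` R)" by (rule ex(1))
    have "card R \<le> card T'" using RT' tiling_finite[OF T'(1)] card_mono by blast
    then show "card ((T' - R) \<union> h ` R) = card T" using ex(2) ch T'(2) by simp
    show "T - ?A \<subseteq> (T' - R) \<union> h ` R" using T'(3) RT by auto
    show "Q \<inter> \<Union> ((T' - R) \<union> h ` R) = {}"
    proof (rule ccontr)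
      assume "\<not> ?thesis"
      then obtain x Z where x: "x \<in> Q" "x \<in> Z" "Z \<in> (T' - R) \<union> h ` R" by auto
      from x(3) show False
      proof
        assume Z: "Z \<in> h ` R"
        then obtain Y where Y: "Y \<in> R" "Z = h Y" by auto
        then have "x = s' Y" using x f[OF Y(1)] by (auto simp: h_def)
        then have "x \<in> s' ` ?A" using Y RT by auto
        then show False using x Q(1) by (auto simp: rest_def)
      next
        assume Z: "Z \<in> T' - R"
        show False
        proof (cases "x \<in> ?L")
          case True
          then show False using T'(4) x Z by auto
        next
          case False
          \<comment> \<open>A vertex of \<open>Q\<close> outside the old rest lies in a strong tile.
            That tile is met by \<open>Q\<close>, so it belongs to \<open>R\<close> and to
            \<open>T'\<close>, and no other tile of \<open>T'\<close> contains the vertex.\<close>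
          have "x \<in> V" "x \<notin> s' ` ?A" "x \<notin> \<Union>(T - ?A)" using x(1) Q(1) by (auto simp: rest_def)
          moreover have "s ` A \<subseteq> s' ` ?A" using s'(1) by (metis UnI1 image_subset_iff imageI)
          ultimately have "x \<in> \<Union>?St" using False unfolding rest_def by blast
          then obtain Y where Y: "Y \<in> R" "x \<in> Y" using x(1) by (auto simp: R_def)
          then show False using T'd[of Y Z] RT' Z x(2) by auto
        qed
      qed
    qed
  qed
qed

text \<open>Each round with at least \<open>g\<close> strong tiles moves all of them into
  \<open>A\<close> and divides the freedom by four. Starting from \<open>8 * 4 ^ M\<close>, a
  freedom of 8 is left after \<open>M\<close> rounds, enough for the later exchanges. As
  \<open>A\<close> cannot outgrow \<open>T\<close>, large \<open>m * g\<close> leaves only the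
  second alternative.\<close>

lemma exists_saturated:
  assumes K: "2 * (8 * 4 ^ M) + 2 \<le> K" and V: "V \<noteq> {}" and "m \<le> M"
  shows "\<exists>A s. A \<subseteq> T \<and> (\<forall>Y\<in>A. s Y \<in> Y) \<and> free A s (8 * 4 ^ (M - m)) \<and>
     (real m * g \<le> real (card A) \<or> real (card (strong K A s)) < g)"
  using \<open>m \<le> M\<close>
proof (induction m)
  case 0
  show ?case
    using free_empty by (intro exI[of _ "{}"]) auto
next
  case (Suc m)
  have e: "M - m = Suc (M - Suc m)" using Suc.prems by simp
  obtain A s where A: "A \<subseteq> T" "\<forall>Y\<in>A. s Y \<in> Y" "free A s (8 * 4 ^ (M - m))"
     "real m * g \<le> real (card A) \<or> real (card (strong K A s)) < g"
    using Suc by auto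
  show ?case
  proof (cases "real (card (strong K A s)) < g")
    case True
    then show ?thesis using A free_mono[OF A(3), of "8 * 4 ^ (M - Suc m)"] e by fastforce
  next
    case False
    let ?St = "strong K A s"
    have "\<forall>Y\<in>?St. \<exists>v. v \<in> Y \<and> K * card V \<le> link (rest A s) v" by (auto simp: strong_def)
    then obtain v where v: "\<forall>Y\<in>?St. v Y \<in> Y \<and> K * card V \<le> link (rest A s) (v Y)" by metis
    have dis: "A \<inter> ?St = {}" "?St \<subseteq> T" by (auto simp: strong_def)
    define s' where "s' = (\<lambda>Y. if Y \<in> A then s Y else v Y)"
    \<comment> \<open>\<open>K\<close> is chosen for the first round, where the number of vertices
      to avoid is largest.\<close>
    have 4: "4 ^ Suc (M - Suc m) \<le> (4::nat) ^ M" using Suc.prems by (intro power_increasing) auto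
    have "free (A \<union> ?St) s' (8 * 4 ^ (M - Suc m))"
    proof (rule free_step[OF A(1) _ _ V])
      show "free A s (4 * (8 * 4 ^ (M - Suc m)))" using A(3) e by simp
      show "2 * (4 * (8 * 4 ^ (M - Suc m))) + 2 \<le> K" using K 4 by simp
    qed (use v dis in \<open>auto simp: s'_def\<close>)
    moreover have "card (A \<union> ?St) = card A + card ?St"
      using A(1) dis tiling_finite[OF til] by (intro card_Un_disjoint) (auto intro: finite_subset)
    moreover have "real m * g + g \<le> real (card A) + real (card ?St)" using False A(4) by auto
    ultimately show ?thesis
      using A(1,2) dis v
      by (intro exI[of _ "A \<union> ?St"] exI[of _ s'] conjI disjI1) (auto simp: s'_def algebra_simps)
  qed
qed

section \<open>Rich pairs and the consequences of maximality\<close>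

text \<open>Some tiling of maximum size avoids the vertices of \<open>P\<close> in the rest and
  still contains \<open>R\<close>; exchanging \<open>R\<close> for \<open>P\<close> in it cannot
  increase the number of tiles.\<close>

lemma no_gain:
  assumes fr: "free A s q" and R: "R \<subseteq> T - A" and P: "tiling V E P"
    and sub: "\<Union>P \<subseteq> rest A s \<union> \<Union>R" and q: "card (\<Union>P \<inter> rest A s) \<le> q"
  shows "card P \<le> card R"
proof -
  obtain T' where T': "tiling V E T'" "card T' = card T" "T - A \<subseteq> T'" "(\<Union>P \<inter> rest A s) \<inter> \<Union>T' = {}"
    using fr q unfolding free_def by (meson Int_lower2)
  have RT': "R \<subseteq> T'" using R T' by auto
  have d: "p \<inter> Y = {}" if "p \<in> P" "Y \<in> T' - R" for p Y
  proof -
    have "Y \<inter> Z = {}" if "Z \<in> R" for Z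
      using T'(1) RT' that \<open>Y \<in> T' - R\<close> unfolding tiling_def disjoint_def by (metis DiffE subsetD)
    then have YR: "Y \<inter> \<Union>R = {}" by blast
    show ?thesis
    proof (rule ccontr)
      assume "p \<inter> Y \<noteq> {}"
      then obtain x where x: "x \<in> p" "x \<in> Y" by auto
      then have "x \<in> \<Union>P" using that by auto
      moreover have "x \<notin> \<Union>R" using YR x by auto
      ultimately show False using T'(4) sub x that by auto
    qed
  qed
  note ex = tiling_exchange[OF T'(1) tiling_finite[OF T'(1)] RT' P tiling_finite[OF P] d]
  have "card R \<le> card T'" using RT' tiling_finite[OF T'(1)] card_mono by blast
  then show ?thesis using max[OF ex(1)] ex(2) T'(2) by linarith
qed

text \<open>The threshold is 10 = 8 + 2: with at most four pairs in play, at most 8 vertices of the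
  rest are excluded, and two common neighbours must survive.\<close>

definition rich :: "'a set \<Rightarrow> 'a \<Rightarrow> 'a \<Rightarrow> bool" where
  "rich L u v \<longleftrightarrow> 10 \<le> card {w \<in> L. {u, v, w} \<in> E}"

lemma rich_commute: "rich L u v = rich L v u"
  unfolding rich_def by (simp add: insert_commute)

text \<open>Each rich pair is completed to a tile by two common neighbours in the rest, chosen
  disjointly for different pairs. At most 8 vertices of the rest are used, so \<open>no_gain\<close>
  applies.\<close>

lemma rich_matching:
  assumes fr: "free A s 8" and R: "R \<subseteq> T - A" and M: "finite M" "card M \<le> 4"
    and rich: "\<And>u v. (u, v) \<in> M \<Longrightarrow> u \<in> \<Union>R \<and> v \<in> \<Union>R \<and> rich (rest A s) u v"
    and match: "disjoint_family_on (\<lambda>(u, v). {u, v}) M"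
  shows "card M \<le> card R"
proof -
  let ?L = "rest A s"
  let ?F = "\<lambda>(u, v). {p. p \<subseteq> ?L \<and> yset E ({u, v} \<union> p)}"
  have "\<exists>f. (\<forall>m\<in>M. f m \<in> ?F m \<and> f m \<inter> {} = {} \<and> finite (f m) \<and> card (f m) \<le> 2) \<and> disjoint_family_on f M"
  proof (rule greedy_disjoint_selection[where k = 8])
    fix m and X :: "'a set" assume m: "m \<in> M" and X: "finite X" "card X \<le> 8"
    obtain u v where uv: "m = (u, v)" by force
    have "10 \<le> card {w \<in> ?L. {u, v, w} \<in> E}" using rich m uv by (auto simp: rich_def)
    then have "2 \<le> card ({w \<in> ?L. {u, v, w} \<in> E} - X)"
      using X diff_card_le_card_Diff[OF X(1), of "{w \<in> ?L. {u, v, w} \<in> E}"] by linarith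
    then obtain S where "S \<subseteq> {w \<in> ?L. {u, v, w} \<in> E} - X" "card S = 2"
      by (meson obtain_subset_with_card_n)
    then obtain y y' where y: "y \<noteq> y'" "{y, y'} \<subseteq> {w \<in> ?L. {u, v, w} \<in> E} - X"
      by (auto simp: card_2_iff)
    then show "\<exists>p\<in>?F m. p \<inter> X = {} \<and> finite p \<and> card p \<le> 2"
      using yset_cherry[of u v y y'] uv by (intro bexI[of _ "{y, y'}"]) auto
  qed (use M in auto)
  then obtain f where f: "\<And>m. m \<in> M \<Longrightarrow> f m \<in> ?F m \<and> finite (f m) \<and> card (f m) \<le> 2"
    and fd: "disjoint_family_on f M" by auto
  define h where "h = (\<lambda>m. {fst m, snd m} \<union> f m)"
  have fL: "f m \<subseteq> ?L" "yset E (h m)" if "m \<in> M" for m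
    using f[OF that] by (auto simp: h_def split: prod.splits)
  have mR: "{fst m, snd m} \<subseteq> \<Union>R" if "m \<in> M" for m using rich[of "fst m" "snd m"] that by auto
  have LR: "?L \<inter> \<Union>R = {}" using R unfolding rest_def by auto
  have hd: "h m \<inter> h m' = {}" if mm: "m \<in> M" "m' \<in> M" "m \<noteq> m'" for m m'
  proof -
    have "{fst m, snd m} \<inter> {fst m', snd m'} = {}"
      using match mm unfolding disjoint_family_on_def by (metis (no_types, lifting) case_prod_beta')
    moreover have "f m \<inter> f m' = {}" using fd mm unfolding disjoint_family_on_def by blast
    moreover have "{fst m, snd m} \<inter> f m' = {}" "{fst m', snd m'} \<inter> f m = {}"
      using mR[OF mm(1)] mR[OF mm(2)] fL(1)[OF mm(1)] fL(1)[OF mm(2)] LR by blast+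
    ultimately show ?thesis unfolding h_def by blast
  qed
  have RV: "\<Union>R \<subseteq> V" using R T_tile by blast
  have hV: "h m \<subseteq> V" if "m \<in> M" for m
    using fL(1)[OF that] mR[OF that] RV rest_subset unfolding h_def by blast
  have P: "tiling V E (h ` M)"
    unfolding tiling_def disjoint_def
  proof (intro conjI ballI impI)
    fix Y assume "Y \<in> h ` M"
    then obtain m where "m \<in> M" "Y = h m" by auto
    then show "yset E Y" "Y \<subseteq> V" using fL(2) hV by auto
  next
    fix Y Z assume "Y \<in> h ` M" "Z \<in> h ` M" "Y \<noteq> Z"
    then show "Y \<inter> Z = {}" using hd by blast
  qed
  have "inj_on h M"
  proof (rule inj_onI)
    fix Y Z assume YZ: "Y \<in> M" "Z \<in> M" "h Y = h Z"
    then have "h Y \<inter> h Z \<noteq> {}" by (auto simp: h_def)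
    then show "Y = Z" using hd YZ by blast
  qed
  then have ch: "card (h ` M) = card M" by (rule card_image)
  have "\<Union>(h ` M) \<inter> ?L \<subseteq> (\<Union>m\<in>M. f m)" using mR LR by (force simp: h_def)
  then have "card (\<Union>(h ` M) \<inter> ?L) \<le> card (\<Union>m\<in>M. f m)" using f M by (intro card_mono) auto
  also have "\<dots> \<le> (\<Sum>m\<in>M. card (f m))" using M by (intro card_UN_le)
  also have "\<dots> \<le> (\<Sum>m\<in>M. 2)" using f by (intro sum_mono) auto
  also have "\<dots> \<le> 8" using M by simp
  finally have "card (\<Union>(h ` M) \<inter> ?L) \<le> 8" .
  moreover have "\<Union>(h ` M) \<subseteq> ?L \<union> \<Union>R" using fL mR by (fastforce simp: h_def)
  ultimately show ?thesis using no_gain[OF fr R P] ch by simp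
qed

text \<open>The exceptional configuration of \<open>bipartite_no_3_matching\<close>, oriented from
  the tile with the two full vertices to the other tile.\<close>

definition arrow :: "'a set \<Rightarrow> 'a set \<Rightarrow> 'a set \<Rightarrow> bool" where
  "arrow L Y Z \<longleftrightarrow> (\<exists>x\<in>Y. \<exists>x'\<in>Y. x \<noteq> x' \<and> (\<forall>z\<in>Z. rich L x z \<and> rich L x' z))"

text \<open>Three disjoint rich pairs between two tiles are excluded by
  \<open>rich_matching\<close>, so eight rich pairs would force an arrow by
  \<open>bipartite_no_3_matching\<close>.\<close>

lemma rich_pairs_or_arrow:
  assumes fr: "free A s 8" and Y: "Y \<in> T - A" and Z: "Z \<in> T - A" and "Y \<noteq> Z"
    and na: "\<not> arrow (rest A s) Y Z" "\<not> arrow (rest A s) Z Y"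
  shows "card {(u, v) \<in> Y \<times> Z. rich (rest A s) u v} \<le> 7"
proof (rule ccontr)
  let ?L = "rest A s"
  let ?R = "{(u, v) \<in> Y \<times> Z. rich ?L u v}"
  assume "\<not> card ?R \<le> 7"
  then have R8: "8 \<le> card ?R" by simp
  have d: "Y \<inter> Z = {}" using T_disj Y Z \<open>Y \<noteq> Z\<close> by auto
  have nomatch: "\<not> distinct [snd p, snd q, snd r]"
    if pqr: "p \<in> ?R" "q \<in> ?R" "r \<in> ?R" "distinct [fst p, fst q, fst r]" for p q r
  proof
    assume ds: "distinct [snd p, snd q, snd r]"
    have "p \<noteq> q" "q \<noteq> r" "p \<noteq> r" using ds by auto
    then have c3: "card {p, q, r} = 3" by simp
    have "card {p, q, r} \<le> card {Y, Z}"
    proof (rule rich_matching[OF fr])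
      show "{Y, Z} \<subseteq> T - A" using Y Z by auto
      show "disjoint_family_on (\<lambda>(u, v). {u, v}) {p, q, r}"
        using pqr ds d by (cases p; cases q; cases r) (auto simp: disjoint_family_on_def)
      show "u \<in> \<Union>{Y, Z} \<and> v \<in> \<Union>{Y, Z} \<and> rich ?L u v" if "(u, v) \<in> {p, q, r}" for u v
        using that pqr by auto
    qed (use c3 in auto)
    then show False using c3 by (simp add: card_insert_if split: if_splits)
  qed
  have "?R \<subseteq> Y \<times> Z" by auto
  from bipartite_no_3_matching[OF this _ _ _ _ R8 nomatch] Y Z T_tile
  have "(\<exists>x x'. x \<noteq> x' \<and> x \<in> Y \<and> x' \<in> Y \<and> {x, x'} \<times> Z \<subseteq> ?R) \<or>
    (\<exists>y y'. y \<noteq> y' \<and> y \<in> Z \<and> y' \<in> Z \<and> Y \<times> {y, y'} \<subseteq> ?R)" by auto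
  then show False
  proof
    assume "\<exists>x x'. x \<noteq> x' \<and> x \<in> Y \<and> x' \<in> Y \<and> {x, x'} \<times> Z \<subseteq> ?R"
    then obtain x x' where "x \<noteq> x'" "x \<in> Y" "x' \<in> Y" "{x, x'} \<times> Z \<subseteq> ?R" by blast
    then have "arrow ?L Y Z" unfolding arrow_def by blast
    then show False using na by simp
  next
    assume "\<exists>y y'. y \<noteq> y' \<and> y \<in> Z \<and> y' \<in> Z \<and> Y \<times> {y, y'} \<subseteq> ?R"
    then obtain y y' where "y \<noteq> y'" "y \<in> Z" "y' \<in> Z" "Y \<times> {y, y'} \<subseteq> ?R" by blast
    then have "arrow ?L Z Y" unfolding arrow_def using rich_commute[of ?L] by blast
    then show False using na by simp
  qed
qed

text \<open>Otherwise the two full vertices of \<open>Y\<close> and the two of \<open>Y'\<close> can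
  be matched to the four vertices of \<open>Z\<close>: four disjoint rich pairs on three
  tiles.\<close>

lemma arrow_unique:
  assumes fr: "free A s 8" and Y: "Y \<in> T - A" "Y' \<in> T - A" "Z \<in> T - A"
    and ne: "Y \<noteq> Z" "Y' \<noteq> Z" and arr: "arrow (rest A s) Y Z" "arrow (rest A s) Y' Z"
  shows "Y = Y'"
proof (rule ccontr)
  let ?L = "rest A s"
  assume "Y \<noteq> Y'"
  then have d: "Y \<inter> Z = {}" "Y' \<inter> Z = {}" "Y \<inter> Y' = {}"
    using T_disj[of Y Z] T_disj[of Y' Z] T_disj[of Y Y'] Y ne by auto
  obtain x x' where x: "x \<in> Y" "x' \<in> Y" "x \<noteq> x'" "\<forall>z\<in>Z. rich ?L x z \<and> rich ?L x' z"
    using arr(1) unfolding arrow_def by blast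
  obtain y y' where y: "y \<in> Y'" "y' \<in> Y'" "y \<noteq> y'" "\<forall>z\<in>Z. rich ?L y z \<and> rich ?L y' z"
    using arr(2) unfolding arrow_def by blast
  have "yset E Z" using T_tile Y by blast
  then obtain z1 z2 z3 z4 where z: "distinct [z1, z2, z3, z4]" "Z = {z1, z2, z3, z4}"
    unfolding yset_def by blast
  let ?M = "{(x, z1), (x', z2), (y, z3), (y', z4)}"
  have c4: "card ?M = 4" using z(1) by auto
  have "card ?M \<le> card {Y, Y', Z}"
  proof (rule rich_matching[OF fr])
    show "{Y, Y', Z} \<subseteq> T - A" using Y by auto
    have "x \<notin> Z" "x' \<notin> Z" "y \<notin> Z" "y' \<notin> Z" "x \<noteq> y" "x \<noteq> y'" "x' \<noteq> y" "x' \<noteq> y'"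
      using x(1,2) y(1,2) d by blast+
    then show "disjoint_family_on (\<lambda>(u, v). {u, v}) ?M"
      using x(3) y(3) z by (auto simp: disjoint_family_on_def)
    show "u \<in> \<Union>{Y, Y', Z} \<and> v \<in> \<Union>{Y, Y', Z} \<and> rich ?L u v" if "(u, v) \<in> ?M" for u v
      using that x y z(2) by auto
  qed (use c4 in auto)
  then show False using c4 by (simp add: card_insert_if split: if_splits)
qed

text \<open>A typical ordered pair of tiles carries at most 7 rich pairs. The exceptions are the
  diagonal, the arrows and the reversed arrows, only linearly many in all.\<close>

lemma card_rich_pairs:
  assumes fr: "free A s 8"
  shows "card {(u, v) \<in> \<Union>(T - A) \<times> \<Union>(T - A). rich (rest A s) u v} \<le> 7 * card (T - A) ^ 2 + 27 * card (T - A)"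
proof -
  let ?L = "rest A s" and ?B = "T - A"
  let ?P = "\<lambda>(Y, Z). {(u, v) \<in> Y \<times> Z. rich ?L u v}"
  have finB: "finite ?B" using tiling_finite[OF til] by simp
  define N where "N = {(Y, Z) \<in> ?B \<times> ?B. Y \<noteq> Z \<and> arrow ?L Y Z}"
  have finN: "finite N" using finB unfolding N_def by (auto intro: finite_subset[of _ "?B \<times> ?B"])
  \<comment> \<open>An arrow is determined by its target, so there are at most as many arrows as
    tiles.\<close>
  have "inj_on snd N"
    unfolding inj_on_def N_def using arrow_unique[OF fr] by auto
  moreover have "snd ` N \<subseteq> ?B" by (auto simp: N_def)
  ultimately have cN: "card N \<le> card ?B" using finB card_inj_on_le by blast
  define D where "D = Id_on ?B \<union> N \<union> N\<inverse>"
  have finD: "finite D" and DB: "D \<subseteq> ?B \<times> ?B" using finB finN by (auto simp: D_def N_def Id_on_def)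
  have "card (Id_on ?B) \<le> card ?B"
  proof -
    have "Id_on ?B = (\<lambda>Y. (Y, Y)) ` ?B" by auto
    then show ?thesis using card_image_le[OF finB, of "\<lambda>Y. (Y, Y)"] by simp
  qed
  then have cD: "card D \<le> 3 * card ?B"
    using cN card_Un_le[of "Id_on ?B \<union> N" "N\<inverse>"] card_Un_le[of "Id_on ?B" N] by (simp add: D_def)
  \<comment> \<open>An exceptional pair carries at most 16 = 7 + 9 rich pairs; at most three
    exceptional pairs per tile give the coefficient 27 = 3 * 9.\<close>
  have "card (?P p) \<le> 7 + 9 * of_bool (p \<in> D)" if p: "p \<in> ?B \<times> ?B" for p
  proof (cases "p \<in> D")
    case True
    obtain Y Z where YZ: "p = (Y, Z)" by force
    have "card (?P p) \<le> card (Y \<times> Z)" unfolding YZ using p YZ T_tile by (intro card_mono) auto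
    also have "\<dots> = 16" using p YZ T_tile by (simp add: card_cartesian_product)
    finally show ?thesis using True by simp
  next
    case False
    then show ?thesis using rich_pairs_or_arrow[OF fr] p by (auto simp: D_def N_def)
  qed
  note le = this
  have "{(u, v) \<in> \<Union>?B \<times> \<Union>?B. rich ?L u v} = (\<Union>p\<in>?B \<times> ?B. ?P p)" by auto
  then have "card {(u, v) \<in> \<Union>?B \<times> \<Union>?B. rich ?L u v} \<le> (\<Sum>p\<in>?B \<times> ?B. card (?P p))"
    using finB by (simp only: card_UN_le finite_cartesian_product)
  also have "\<dots> \<le> (\<Sum>p\<in>?B \<times> ?B. 7 + 9 * of_bool (p \<in> D))" using le by (rule sum_mono)
  also have "\<dots> = 7 * card ?B ^ 2 + 9 * card D"
  proof -
    have "(\<Sum>p\<in>?B \<times> ?B. of_bool (p \<in> D)) = card ((?B \<times> ?B) \<inter> {p. p \<in> D})"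
      using finB by (subst sum_of_bool_eq) auto
    also have "(?B \<times> ?B) \<inter> {p. p \<in> D} = D" using DB by auto
    finally show ?thesis
      by (simp add: sum.distrib card_cartesian_product power2_eq_square flip: sum_distrib_left)
  qed
  finally show ?thesis using cD by linarith
qed

section \<open>Bounding the edges by their number of vertices in the rest\<close>

text \<open>Two vertices of the rest with two common neighbours there would span a tile inside the
  rest, a gain with nothing removed. So each ordered pair extends to at most one triple.\<close>

lemma triples_rest:
  assumes fr: "free A s 8"
  shows "triples E (rest A s) (rest A s) (rest A s) \<le> card V ^ 2"
proof -
  let ?L = "rest A s"
  have "card {z \<in> ?L. {x, y, z} \<in> E} \<le> 1" if xy: "x \<in> ?L" "y \<in> ?L" for x y
  proof (rule ccontr)
    assume "\<not> ?thesis"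
    then have "2 \<le> card {z \<in> ?L. {x, y, z} \<in> E}" by simp
    then obtain S where "S \<subseteq> {z \<in> ?L. {x, y, z} \<in> E}" "card S = 2"
      by (meson obtain_subset_with_card_n)
    then obtain z z' where z: "z \<noteq> z'" "{z, z'} \<subseteq> {z \<in> ?L. {x, y, z} \<in> E}"
      by (auto simp: card_2_iff)
    then have Y: "yset E {x, y, z, z'}" by (intro yset_cherry) auto
    have sub: "{x, y, z, z'} \<subseteq> ?L" using xy z by auto
    have "card {{x, y, z, z'}} \<le> card ({} :: 'a set set)"
    proof (rule no_gain[OF fr])
      show "tiling V E {{x, y, z, z'}}"
        using Y sub rest_subset unfolding tiling_def disjoint_def by blast
      show "card (\<Union>{{x, y, z, z'}} \<inter> ?L) \<le> 8"
        using yset_card[OF Y] sub by (simp add: Int_absorb2)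
    qed (use sub in auto)
    then show False by simp
  qed
  then have "triples E ?L ?L ?L \<le> (\<Sum>x\<in>?L. \<Sum>y\<in>?L. 1)"
    unfolding triples_card[OF finite_rest] by (intro sum_mono)
  also have "\<dots> = card ?L ^ 2" by (simp add: power2_eq_square)
  also have "\<dots> \<le> card V ^ 2" using rest_subset finV by (intro power_mono card_mono) auto
  finally show ?thesis .
qed

text \<open>The vertices of strong tiles get the trivial bound \<open>card V ^ 2\<close>; every
  other vertex has a link below the threshold \<open>K * card V\<close>.\<close>

lemma triples_weak:
  "triples E (\<Union>(T - A)) (rest A s) (rest A s) \<le> 4 * card (strong K A s) * card V ^ 2 + K * card V ^ 2"
proof -
  let ?L = "rest A s" and ?W = "\<Union>(T - A)" and ?S = "\<Union>(strong K A s)"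
  have StT: "strong K A s \<subseteq> T" by (auto simp: strong_def)
  have WV: "?W \<subseteq> V" using T_tile by blast
  then have finW: "finite ?W" using finV finite_subset by blast
  have SW: "?S \<subseteq> ?W" by (auto simp: strong_def)
  have LV: "card ?L \<le> card V" using rest_subset finV card_mono by blast
  have "triples E ?W ?L ?L = (\<Sum>v\<in>?W. link ?L v)"
    unfolding triples_card[OF finite_rest] link_def ..
  also have "\<dots> = (\<Sum>v\<in>?S. link ?L v) + (\<Sum>v\<in>?W - ?S. link ?L v)"
    using sum.subset_diff[OF SW finW, of "link ?L"] by simp
  also have "\<dots> \<le> (\<Sum>v\<in>?S. card V ^ 2) + (\<Sum>v\<in>?W - ?S. K * card V)"
  proof (intro add_mono sum_mono)
    fix v
    have "link ?L v \<le> (\<Sum>x\<in>?L. card V)"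
      unfolding link_def using rest_subset finV by (intro sum_mono card_mono) auto
    also have "\<dots> \<le> card V ^ 2" using LV by (simp add: power2_eq_square)
    finally show "link ?L v \<le> card V ^ 2" .
  next
    fix v assume "v \<in> ?W - ?S"
    then have "\<not> K * card V \<le> link ?L v" by (auto simp: strong_def)
    then show "link ?L v \<le> K * card V" by simp
  qed
  also have "\<dots> = 4 * card (strong K A s) * card V ^ 2 + card (?W - ?S) * (K * card V)"
    using card_Union_tiles[OF StT] by simp
  also have "card (?W - ?S) * (K * card V) \<le> card V * (K * card V)"
    using WV finV by (intro mult_right_mono card_mono) auto
  finally show ?thesis by (simp add: power2_eq_square algebra_simps)
qed

text \<open>A pair that is not rich has fewer than 10 common neighbours in the rest, and a rich pair
  may have all of the rest; \<open>card_rich_pairs\<close> limits the rich pairs.\<close>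

lemma triples_two_tiles:
  assumes fr: "free A s 8"
  shows "triples E (\<Union>(T - A)) (\<Union>(T - A)) (rest A s) \<le>
    10 * card V ^ 2 + card (rest A s) * (7 * card (T - A) ^ 2 + 27 * card (T - A))"
proof -
  let ?L = "rest A s" and ?W = "\<Union>(T - A)"
  have WV: "?W \<subseteq> V" using T_tile by blast
  then have finW: "finite ?W" using finV finite_subset by blast
  have "triples E ?W ?W ?L = (\<Sum>p\<in>?W \<times> ?W. card {z \<in> ?L. {fst p, snd p, z} \<in> E})"
    unfolding triples_card[OF finite_rest] by (simp add: sum.cartesian_product case_prod_beta)
  also have "\<dots> \<le> (\<Sum>p\<in>?W \<times> ?W. 10 + card ?L * of_bool (p \<in> {(u, v). rich ?L u v}))"
  proof (rule sum_mono)
    fix p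
    have "card {z \<in> ?L. {fst p, snd p, z} \<in> E} \<le> card ?L" using finite_rest by (intro card_mono) auto
    then show "card {z \<in> ?L. {fst p, snd p, z} \<in> E} \<le> 10 + card ?L * of_bool (p \<in> {(u, v). rich ?L u v})"
      by (cases p) (auto simp: rich_def)
  qed
  also have "\<dots> = 10 * (card ?W * card ?W) + card ?L * card {(u, v) \<in> ?W \<times> ?W. rich ?L u v}"
  proof -
    have "(\<Sum>p\<in>?W \<times> ?W. of_bool (p \<in> {(u, v). rich ?L u v})) = card ((?W \<times> ?W) \<inter> {p. p \<in> {(u, v). rich ?L u v}})"
      using finW by (subst sum_of_bool_eq) auto
    also have "(?W \<times> ?W) \<inter> {p. p \<in> {(u, v). rich ?L u v}} = {(u, v) \<in> ?W \<times> ?W. rich ?L u v}" by auto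
    finally show ?thesis
      by (simp only: sum.distrib sum_constant card_cartesian_product flip: sum_distrib_left) simp
  qed
  also have "\<dots> \<le> 10 * (card V * card V) + card ?L * (7 * card (T - A) ^ 2 + 27 * card (T - A))"
  proof (intro add_mono)
    show "10 * (card ?W * card ?W) \<le> 10 * (card V * card V)"
      using WV finV by (intro mult_left_mono mult_mono card_mono) auto
    show "card ?L * card {(u, v) \<in> ?W \<times> ?W. rich ?L u v} \<le> card ?L * (7 * card (T - A) ^ 2 + 27 * card (T - A))"
      using card_rich_pairs[OF fr] by (rule mult_left_mono) simp
  qed
  finally show ?thesis by (simp add: power2_eq_square)
qed

text \<open>Triples meeting the vertices chosen by \<open>s\<close> are bounded trivially through
  \<open>triples_outside\<close>. The others are split by their number of vertices in the rest, each
  class having its own bound.\<close>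

lemma saturated_edge_bound:
  assumes A: "A \<subseteq> T" "\<And>Y. Y \<in> A \<Longrightarrow> s Y \<in> Y" and fr: "free A s 8" and t: "7 * card T \<le> card V"
  shows "6 * real (card E) \<le> real (card V) ^ 3 - (real (card V) - real (card T)) ^ 3
    + 12 * real (card (strong K A s)) * real (card V) ^ 2 + (3 * real K + 112) * real (card V) ^ 2"
proof -
  let ?L = "rest A s" and ?W = "\<Union>(T - A)"
  define n a b l where "n = card V" and "a = card A" and "b = card (T - A)" and "l = card ?L"
  let ?D = "?L \<union> ?W"
  have finA: "finite A" using A tiling_finite[OF til] finite_subset by blast
  have WV: "?W \<subseteq> V" using T_tile by blast
  then have finW: "finite ?W" using finV finite_subset by blast
  have ct: "card T = a + b"
    using A(1) finA tiling_finite[OF til] unfolding a_def b_def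
    by (simp add: card_Diff_subset card_mono)
  have disj: "?L \<inter> ?W = {}" by (auto simp: rest_def)
  have cW: "card ?W = 4 * b" unfolding b_def by (rule card_Union_tiles) auto
  have sA: "s Y \<noteq> s Z" if "Y \<in> A" "Z \<in> T" "Y \<noteq> Z" "s Z \<in> Z" for Y Z
    using A that T_disj[of Y Z] by (metis disjoint_iff subsetD)
  have "inj_on s A" using sA A unfolding inj_on_def by blast
  then have csA: "card (s ` A) = a" unfolding a_def by (rule card_image)
  have sW: "s ` A \<inter> ?W = {}"
  proof (rule ccontr)
    assume "s ` A \<inter> ?W \<noteq> {}"
    then obtain Y Z where "Y \<in> A" "Z \<in> T - A" "s Y \<in> Z" by auto
    then show False using A T_disj[of Y Z] by blast
  qed
  have sV: "s ` A \<subseteq> V" using A T_tile by blast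
  have D: "?D = V - s ` A" using sW WV by (auto simp: rest_def)
  have cD: "card ?D = l + 4 * b"
    unfolding l_def cW[symmetric] using finite_rest finW disj by (rule card_Un_disjoint)
  have "card ?D + a = n"
    unfolding D csA[symmetric] n_def using sV finV by (simp add: card_Diff_subset finite_subset card_mono)
  then have n: "n = a + l + 4 * b" using cD by simp
  have "6 * card E \<le> triples E V V V" by (rule card_edges_triples[OF finV edge])
  moreover have "triples E V V V + (l + 4 * b) ^ 3 \<le> n ^ 3 + triples E ?D ?D ?D"
    using triples_outside[OF finV, of ?D E] D cD unfolding n_def by simp
  moreover have "triples E ?D ?D ?D =
    triples E ?L ?L ?L + 3 * triples E ?W ?L ?L + 3 * triples E ?W ?W ?L + triples E ?W ?W ?W"
    using finite_rest finW disj by (rule triples_cube_Un)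
  moreover have "triples E ?L ?L ?L \<le> n ^ 2" unfolding n_def by (rule triples_rest[OF fr])
  moreover have "triples E ?W ?L ?L \<le> 4 * card (strong K A s) * n ^ 2 + K * n ^ 2"
    unfolding n_def by (rule triples_weak)
  moreover have "triples E ?W ?W ?L \<le> 10 * n ^ 2 + l * (7 * b ^ 2 + 27 * b)"
    unfolding n_def l_def b_def by (rule triples_two_tiles[OF fr])
  moreover have "triples E ?W ?W ?W \<le> 64 * b ^ 3"
    using triples_le[of E ?W ?W ?W] cW by (simp add: power3_eq_cube)
  moreover have "27 * l * b \<le> 27 * n ^ 2"
    using n by (simp add: power2_eq_square algebra_simps)
  \<comment> \<open>The quadratic errors add up to 112 = 1 + 3 * 10 + 3 * 27, and the coefficient 21
    is 3 * 7.\<close>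
  ultimately have "6 * card E + (l + 4 * b) ^ 3 \<le>
      n ^ 3 + 12 * card (strong K A s) * n ^ 2 + (3 * K + 112) * n ^ 2 + 21 * l * b ^ 2 + 64 * b ^ 3"
    by (simp add: algebra_simps)
  then have "real (6 * card E + (l + 4 * b) ^ 3) \<le>
      real (n ^ 3 + 12 * card (strong K A s) * n ^ 2 + (3 * K + 112) * n ^ 2 + 21 * l * b ^ 2 + 64 * b ^ 3)"
    by (rule of_nat_mono)
  then have "6 * real (card E) + (real l + 4 * real b) ^ 3 \<le> real n ^ 3
      + 12 * real (card (strong K A s)) * real n ^ 2 + (3 * real K + 112) * real n ^ 2
      + 21 * real l * real b ^ 2 + 64 * real b ^ 3" by simp
  moreover have "21 * real l * real b ^ 2 + 64 * real b ^ 3 \<le>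
      (real l + 4 * real b) ^ 3 - (real l + 3 * real b) ^ 3"
  proof -
    \<comment> \<open>This product is the difference of the two sides. It is nonnegative because
      \<open>7 * card T \<le> card V\<close> amounts to
      \<open>6 * a + 3 * b \<le> l\<close>.\<close>
    have "0 \<le> 3 * real b * (real l + 3 * real b) * (real l - 3 * real b)"
      using t n ct unfolding n_def by (intro mult_nonneg_nonneg) auto
    then show ?thesis by (simp add: power2_eq_square power3_eq_cube algebra_simps)
  qed
  moreover have "real n - real (card T) = real l + 3 * real b" using n ct by simp
  ultimately show ?thesis unfolding n_def[symmetric] by simp
qed

end

section \<open>Return to hypergraphs and comparison with the edge hypothesis\<close>

lemma exists_max_tiling:
  assumes "finite V"
  shows "\<exists>T. tiling V E T \<and> (\<forall>T'. tiling V E T' \<longrightarrow> card T' \<le> card T)"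
proof -
  have "\<forall>T. tiling V E T \<longrightarrow> card T < Suc (card (Pow V))"
    using assms by (auto simp: tiling_def less_Suc_eq_le intro!: card_mono)
  moreover have "tiling V E {}" by (simp add: tiling_def)
  ultimately show ?thesis by (rule ex_has_greatest_nat[rotated])
qed

lemma tiling_Y32:
  assumes H: "three_graph H" and T: "tiling (verts H) (edges H) T"
  shows "\<exists>T'. Y32_tiling H T' \<and> covered T' = \<Union>T"
proof -
  have "\<exists>Y. is_Y32 Y \<and> subhypergraph Y H \<and> verts Y = Q" if Q: "Q \<in> T" for Q
  proof -
    have "yset (edges H) Q" and QV: "Q \<subseteq> verts H" using T Q by (auto simp: tiling_def)
    then obtain a b c d where d: "distinct [a, b, c, d]" "Q = {a, b, c, d}"
        "{a, b, c} \<in> edges H" "{a, b, d} \<in> edges H"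
      unfolding yset_def by blast
    have "{a, b, c} \<inter> {a, b, d} = {a, b}" "{a, b, c} \<noteq> {a, b, d}" using d(1) by auto
    then have "\<exists>e f. {{a, b, c}, {a, b, d}} = {e, f} \<and> e \<noteq> f \<and> card (e \<inter> f) = 2"
      using d(1) by (intro exI[of _ "{a, b, c}"] exI[of _ "{a, b, d}"]) simp
    then show ?thesis
      using d QV by (intro exI[of _ "(Q, {{a, b, c}, {a, b, d}})"])
        (simp add: is_Y32_def three_graph_def subhypergraph_def verts_def edges_def)
  qed
  then obtain y where y: "\<And>Q. Q \<in> T \<Longrightarrow> is_Y32 (y Q) \<and> subhypergraph (y Q) H \<and> verts (y Q) = Q"
    by metis
  have "Y32_tiling H (y ` T)"
    using y T unfolding Y32_tiling_def tiling_def disjoint_def pairwise_def disjnt_def by (metis imageE)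
  moreover have "covered (y ` T) = \<Union>T" using y by (auto simp: covered_def)
  ultimately show ?thesis by blast
qed

lemma gbinomial_3: "(x :: real) gchoose 3 = x * (x - 1) * (x - 2) / 6"
  by (simp add: gbinomial_prod_rev numeral_3_eq_3 fact_numeral algebra_simps)

theorem theorem1p4:
  fixes \<alpha> \<epsilon> :: real
  assumes "0 < \<alpha>" and "\<alpha> \<le> 1/7" and "0 < \<epsilon>" and "\<epsilon> \<le> 1/7"
  shows "\<exists>n0 :: nat. \<forall>n \<ge> n0. \<forall>H :: 'a hypergraph.
     three_graph H \<and> card (verts H) = n \<and>
     real (card (edges H)) \<ge>
       (real n gchoose 3) - ((real n - \<alpha> * real n) gchoose 3) + \<epsilon> * real n ^ 3
     \<longrightarrow> (\<exists>T. Y32_tiling H T \<and> real (card (covered T)) \<ge> 4 * \<alpha> * real n)"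
proof -
  \<comment> \<open>With \<open>\<epsilon> / 4 * real n\<close> strong tiles moved per round,
    \<open>M\<close> rounds would collect more than \<open>n\<close> tiles, so the iteration must
    end with few strong tiles.\<close>
  obtain M :: nat where M: "4 / \<epsilon> < real M" using reals_Archimedean2 by blast
  define K :: nat where "K = 2 * (8 * 4 ^ M) + 2"
  \<comment> \<open>The numerator collects the quadratic errors: \<open>3 * K + 112\<close> from
    \<open>saturated_edge_bound\<close>, and 3 from replacing \<open>6 * (n gchoose 3)\<close> by
    \<open>n ^ 3\<close>.\<close>
  obtain n1 :: nat where n1: "(3 * real K + 115) / (3 * \<epsilon>) < real n1" using reals_Archimedean2 by blast
  show ?thesis
  proof (intro exI[of _ "max n1 1"] allI impI)
    fix n :: nat and H :: "'a hypergraph"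
    assume n: "max n1 1 \<le> n" and "three_graph H \<and> card (verts H) = n \<and> real (card (edges H)) \<ge>
       (real n gchoose 3) - ((real n - \<alpha> * real n) gchoose 3) + \<epsilon> * real n ^ 3"
    then have H: "three_graph H" and cV: "card (verts H) = n" and cE: "real (card (edges H)) \<ge>
       (real n gchoose 3) - ((real n - \<alpha> * real n) gchoose 3) + \<epsilon> * real n ^ 3" by auto
    have n1': "1 \<le> real n" and "real n1 \<le> real n" using n by auto
    then have "(3 * real K + 115) / (3 * \<epsilon>) < real n" using n1 by linarith
    then have big: "3 * real K + 115 < 3 * \<epsilon> * real n"
      using assms(3) by (simp add: field_simps)
    obtain T where T: "tiling (verts H) (edges H) T"
        "\<And>T'. tiling (verts H) (edges H) T' \<Longrightarrow> card T' \<le> card T"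
      using exists_max_tiling[of "verts H" "edges H"] H by (auto simp: three_graph_def)
    interpret max_tiling "verts H" "edges H" T
      using H T by unfold_locales (auto simp: three_graph_def)
    have "\<alpha> * real n \<le> real (card T)"
    proof (rule ccontr)
      assume "\<not> ?thesis"
      then have t: "real (card T) < \<alpha> * real n" by simp
      also have "\<dots> \<le> real n / 7" using assms(2) mult_right_mono[of \<alpha> "1/7" "real n"] by simp
      finally have t7: "7 * real (card T) < real n" by simp
      have "verts H \<noteq> {}" using cV n1' by auto
      from exists_saturated[OF _ this, of M K M "\<epsilon> / 4 * real n"]
      obtain A s where A: "A \<subseteq> T" "\<forall>Y\<in>A. s Y \<in> Y" "free A s 8"
          "real M * (\<epsilon> / 4 * real n) \<le> real (card A) \<or> real (card (strong K A s)) < \<epsilon> / 4 * real n"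
        unfolding K_def by auto
      have "real (card A) \<le> real (card T)" using A(1) tiling_finite[OF til] card_mono by simp
      moreover have "real n < real M * (\<epsilon> / 4 * real n)"
        using M assms(3) n1' by (simp add: field_simps)
      ultimately have few: "real (card (strong K A s)) < \<epsilon> / 4 * real n" using A(4) t7 by linarith
      have "6 * real (card (edges H)) \<le> real n ^ 3 - (real n - real (card T)) ^ 3
          + 12 * real (card (strong K A s)) * real n ^ 2 + (3 * real K + 112) * real n ^ 2"
        using saturated_edge_bound[OF A(1) _ A(3), of K] A(2) t7 cV by simp
      \<comment> \<open>The strong tiles consume half of the surplus
        \<open>6 * \<epsilon> * n ^ 3\<close>; the other half exceeds the quadratic errors.\<close>
      moreover have "12 * real (card (strong K A s)) * real n ^ 2 \<le> 12 * (\<epsilon> / 4 * real n) * real n ^ 2"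
        using few by (intro mult_right_mono) auto
      moreover define x where "x = real n - \<alpha> * real n"
      have "\<alpha> * real n \<le> 1 / 7 * real n" using assms(2) by (intro mult_right_mono) auto
      \<comment> \<open>From 2/3 on, \<open>x ^ 3 - 6 * (x gchoose 3) = x * (3 * x - 2)\<close> is
        nonnegative.\<close>
      then have x: "2 / 3 \<le> x" using n1' unfolding x_def by linarith
      have "x \<le> real n - real (card T)" using t unfolding x_def by simp
      then have "x ^ 3 \<le> (real n - real (card T)) ^ 3" using x by (intro power_mono) auto
      moreover have "6 * (x gchoose 3) \<le> x ^ 3"
      proof -
        have "0 \<le> x * (3 * x - 2)" using x by (intro mult_nonneg_nonneg) auto
        then show ?thesis by (simp add: gbinomial_3 power3_eq_cube algebra_simps)
      qed
      moreover have "6 * (real n gchoose 3) \<ge> real n ^ 3 - 3 * real n ^ 2"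
        by (simp add: gbinomial_3 power3_eq_cube power2_eq_square algebra_simps)
      moreover have "(3 * real K + 115) * real n ^ 2 < 3 * \<epsilon> * real n * real n ^ 2"
        using big n1' by (intro mult_strict_right_mono) auto
      ultimately show False using cE unfolding x_def[symmetric]
        by (simp add: power3_eq_cube power2_eq_square algebra_simps)
    qed
    moreover obtain T' where "Y32_tiling H T'" "covered T' = \<Union>T" using tiling_Y32[OF H T(1)] by blast
    moreover have "card (\<Union>T) = 4 * card T" by (rule card_Union_tiles) simp
    ultimately show "\<exists>T. Y32_tiling H T \<and> real (card (covered T)) \<ge> 4 * \<alpha> * real n"
      by (intro exI[of _ T']) simp
  qed
qed

end
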